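(* There exist functions $f_n,g_n \colon \{0,1\}^n \rightarrow \{0,1\}$ for $n \in \mathbb{N}$ such that $\{f_n\}_{n \in \mathbb{N}} \in \mathsf{AC}^0_2$, $\{g_n\}_{n \in \mathbb{N}} \notin \mathsf{AC}^0$, and for every $n \in \mathbb{N}$ and every restriction $\rho$ on $n$ variables such that $f_n^\rho$ is constant, the function $g_n^\rho$ is also constant.
   Context: $\mathsf{AC}^0_d$ denotes the class of families $\{h_n\}_{n\in\mathbb{N}}$ of functions $h_n\colon\{0,1\}^n\to\{0,1\}$ computable by a (non-uniform) family of circuits $(C_n)_{n\in\mathbb{N}}$ of size polynomial in $n$ and depth $d$, where circuits are built from $\wedge$- and $\vee$-gates of unbounded fan-in, with inputs being constants $0,1$ and literals $x_i,\overline{x}_i$ (negations occur only at the inputs), and depth is the maximal number of $\wedge/\vee$-gates on a path from an input to the output. $\mathsf{AC}^0=\bigcup_{d\in\mathbb{N}}\mathsf{AC}^0_d$. A restriction on $n$ variables is a function $\rho\colon\{0,\dots,n-1\}\to\{0,1,*\}$. For $h\colon\{0,1\}^n\to\{0,1\}$, the restricted function $h^\rho$ has domain $\{0,1\}^{\rho^{-1}(\{*\})}$: given values for the variables $x_i$ with $\rho(i)=*$, it evaluates $h$ on the input obtained by setting every other $x_i$ to $\rho(i)$. *)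

theory Defs
  imports "HOL-Library.FuncSet"
begin

text \<open>The cube $\{0,1\}^I$, as extensional functions. A function $\{0,1\}^n \to \{0,1\}$ is
  represented by some \<open>h :: (nat \<Rightarrow> bool) \<Rightarrow> bool\<close> of which only the values on \<open>cube {..<n}\<close> are
  relevant.\<close>

definition cube :: "nat set \<Rightarrow> (nat \<Rightarrow> bool) set" where
  "cube I = I \<rightarrow>\<^sub>E (UNIV :: bool set)"


text \<open>A circuit is a directed acyclic graph, presented as a list of gates in topological order:
  \<open>Gate j\<close> refers to the \<open>j\<close>-th gate of the list, and a gate may only refer to gates strictly
  before it. \<open>Lit i True\<close> is the literal $x_i$ and \<open>Lit i False\<close> is $\overline{x}_i$.\<close>

datatype node = Const bool | Lit nat bool | Gate nat

datatype gate = And (fanin: "node set") | Or (fanin: "node set")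

datatype circuit = Circuit (gates: "gate list") (out: node)

fun wf_node :: "nat \<Rightarrow> nat \<Rightarrow> node \<Rightarrow> bool" where
  "wf_node n k (Const b) \<longleftrightarrow> True"
| "wf_node n k (Lit i b) \<longleftrightarrow> i < n"
| "wf_node n k (Gate j) \<longleftrightarrow> j < k"

text \<open>The fan-in is unbounded, but nonempty (the constants are available as inputs), so that every
  gate lies on a path starting in an input.\<close>

definition wf_circuit :: "nat \<Rightarrow> circuit \<Rightarrow> bool" where
  "wf_circuit n C \<longleftrightarrow>
     (\<forall>k < length (gates C). fanin (gates C ! k) \<noteq> {} \<and> (\<forall>v \<in> fanin (gates C ! k). wf_node n k v)) \<and>
     wf_node n (length (gates C)) (out C)"

text \<open>In the next two definitions \<open>vs\<close> is the list of values of the preceding gates.\<close>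

fun node_value :: "(nat \<Rightarrow> bool) \<Rightarrow> bool list \<Rightarrow> node \<Rightarrow> bool" where
  "node_value x vs (Const b) = b"
| "node_value x vs (Lit i b) = (x i = b)"
| "node_value x vs (Gate j) = vs ! j"

fun gate_value :: "(nat \<Rightarrow> bool) \<Rightarrow> bool list \<Rightarrow> gate \<Rightarrow> bool" where
  "gate_value x vs (And A) = (\<forall>v \<in> A. node_value x vs v)"
| "gate_value x vs (Or A) = (\<exists>v \<in> A. node_value x vs v)"

definition gate_values :: "(nat \<Rightarrow> bool) \<Rightarrow> gate list \<Rightarrow> bool list" where
  "gate_values x gs = foldl (\<lambda>vs g. vs @ [gate_value x vs g]) [] gs"

definition circuit_value :: "circuit \<Rightarrow> (nat \<Rightarrow> bool) \<Rightarrow> bool" where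
  "circuit_value C x = node_value x (gate_values x (gates C)) (out C)"

definition circuit_size :: "circuit \<Rightarrow> nat" where
  "circuit_size C = length (gates C)"

text \<open>\<open>input_path gs v m\<close>: some path from an input to the node \<open>v\<close> contains exactly \<open>m\<close> gates.\<close>

inductive input_path :: "gate list \<Rightarrow> node \<Rightarrow> nat \<Rightarrow> bool" for gs where
  const: "input_path gs (Const b) 0"
| lit: "input_path gs (Lit i b) 0"
| gate: "input_path gs (Gate j) (Suc m)"
    if "j < length gs" "v \<in> fanin (gs ! j)" "input_path gs v m"

text \<open>For well-formed circuits this set is finite and nonempty.\<close>

definition circuit_depth :: "circuit \<Rightarrow> nat" where
  "circuit_depth C = Max {m. input_path (gates C) (out C) m}"


text \<open>Depth at most \<open>d\<close> and depth exactly \<open>d\<close> define the same class, since a circuit can be padded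
  with gates of fan-in one.\<close>

definition AC0_depth :: "nat \<Rightarrow> (nat \<Rightarrow> (nat \<Rightarrow> bool) \<Rightarrow> bool) set" where
  "AC0_depth d = {h. \<exists>C :: nat \<Rightarrow> circuit.
     (\<forall>n. wf_circuit n (C n) \<and> circuit_depth (C n) \<le> d \<and>
          (\<forall>x \<in> cube {..<n}. circuit_value (C n) x = h n x)) \<and>
     (\<exists>c k. \<forall>n. circuit_size (C n) \<le> c * n ^ k + c)}"

definition AC0 :: "(nat \<Rightarrow> (nat \<Rightarrow> bool) \<Rightarrow> bool) set" where
  "AC0 = (\<Union>d. AC0_depth d)"


text \<open>\<open>None\<close> plays the role of the symbol $*$.\<close>

definition restrictions :: "nat \<Rightarrow> (nat \<Rightarrow> bool option) set" where
  "restrictions n = {..<n} \<rightarrow>\<^sub>E (UNIV :: bool option set)"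

definition free_vars :: "nat \<Rightarrow> (nat \<Rightarrow> bool option) \<Rightarrow> nat set" where
  "free_vars n \<rho> = {i. i < n \<and> \<rho> i = None}"

text \<open>The restricted function $h^\rho$, with domain \<open>cube (free_vars n \<rho>)\<close>.\<close>

definition restricted ::
  "nat \<Rightarrow> ((nat \<Rightarrow> bool) \<Rightarrow> bool) \<Rightarrow> (nat \<Rightarrow> bool option) \<Rightarrow> (nat \<Rightarrow> bool) \<Rightarrow> bool" where
  "restricted n h \<rho> y =
     h (\<lambda>i\<in>{..<n}. case \<rho> i of None \<Rightarrow> y i | Some b \<Rightarrow> b)"

definition restricted_const ::
  "nat \<Rightarrow> ((nat \<Rightarrow> bool) \<Rightarrow> bool) \<Rightarrow> (nat \<Rightarrow> bool option) \<Rightarrow> bool" where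
  "restricted_const n h \<rho> \<longleftrightarrow> (\<exists>c. \<forall>y \<in> cube (free_vars n \<rho>). restricted n h \<rho> y = c)"

end

theory Submission
  imports Defs "HOL-Real_Asymp.Real_Asymp"
begin

text \<open>The implication ``\<open>f\<^sup>\<rho>\<close> constant \<open>\<Longrightarrow>\<close> \<open>g\<^sup>\<rho>\<close> constant'' says that \<open>g\<close> is constant on every subcube on
  which \<open>f\<close> is constant. It puts hardly any constraint on \<open>g\<close> if the zeros of \<open>f\<close> are
  \<^emph>\<open>isolated\<close>, i.e. no two of them are neighbours in the cube: then \<open>f\<close> vanishes identically only on
  subcubes consisting of one point, where \<open>g\<close> is trivially constant. So if \<open>g\<close> vanishes wherever
  \<open>f\<close> takes the value \<open>1\<close>, its values on the zeros of \<open>f\<close> can be chosen freely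
  (\<open>restricted_const_if_isolated_zeros\<close>).

  It remains to find a depth-2 function with many isolated zeros. Group the variables into pairs
  $x_{2i}, x_{2i+1}$ and let \<open>f\<close> test whether some pair is unequal (for odd \<open>n\<close>, the leftover
  variable is compared with \<open>0\<close>). This is a disjunction of linearly many conjunctions of at most two
  literals. In each of its zeros a coordinate is determined by the others, so changing a single
  coordinate leaves the set of zeros; and there are $2^{\lfloor n/2 \rfloor}$ zeros, one for each choice
  of the common bits of the pairs.
  Hence there are $2^{2^{\lfloor n/2 \rfloor}}$ candidates for \<open>g\<close> in dimension \<open>n\<close>, doubly
  exponentially many, and Shannon's counting argument applies: there are only $2^{O((n+s)s)}$
  circuits with at most \<open>s\<close> gates, so for $s = 2^{\lfloor n/8 \rfloor}$ and large \<open>n\<close> some candidate has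
  no circuit with at most \<open>s\<close> gates, whatever the depth. As \<open>s\<close> grows faster than every polynomial, such a
  choice of \<open>g\<close> lies outside AC0.\<close>


section \<open>Isolated zeros\<close>

definition zeros :: "nat \<Rightarrow> ((nat \<Rightarrow> bool) \<Rightarrow> bool) \<Rightarrow> (nat \<Rightarrow> bool) set" where
  "zeros n h = {x \<in> cube {..<n}. \<not> h x}"

definition isolated_zeros :: "nat \<Rightarrow> ((nat \<Rightarrow> bool) \<Rightarrow> bool) \<Rightarrow> bool" where
  "isolated_zeros n h \<longleftrightarrow> (\<forall>x \<in> zeros n h. \<forall>i < n. x(i := \<not> x i) \<notin> zeros n h)"

text \<open>If \<open>f\<close> is constantly \<open>1\<close> on the subcube of \<open>\<rho>\<close>, then \<open>g\<close> is constantly \<open>0\<close> there. If \<open>f\<close> is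
  constantly \<open>0\<close>, the subcube contains no two neighbours, so it is a single point.\<close>

lemma restricted_const_if_isolated_zeros:
  assumes iso: "isolated_zeros n f"
    and sub: "\<And>x. x \<in> cube {..<n} \<Longrightarrow> g x \<Longrightarrow> \<not> f x"
    and const: "restricted_const n f \<rho>"
  shows "restricted_const n g \<rho>"
proof -
  define fill where "fill y = (\<lambda>i\<in>{..<n}. case \<rho> i of None \<Rightarrow> y i | Some b \<Rightarrow> b)"
    for y :: "nat \<Rightarrow> bool"
  have fill_cube: "fill y \<in> cube {..<n}" for y
    by (simp add: fill_def cube_def)
  have restr: "restricted n h \<rho> y = h (fill y)" for h y
    by (simp add: restricted_def fill_def)
  obtain c where c: "\<And>y. y \<in> cube (free_vars n \<rho>) \<Longrightarrow> f (fill y) = c"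
    using const by (auto simp: restricted_const_def restr)
  show ?thesis
  proof (cases c)
    case True
    then have "\<not> g (fill y)" if "y \<in> cube (free_vars n \<rho>)" for y
      using c[OF that] sub[OF fill_cube] by blast
    then show ?thesis
      by (auto simp: restricted_const_def restr)
  next
    case False
    have zero: "fill y \<in> zeros n f" if "y \<in> cube (free_vars n \<rho>)" for y
      using c[OF that] False fill_cube by (simp add: zeros_def)
    have "free_vars n \<rho> = {}"
    proof (rule ccontr)
      assume "free_vars n \<rho> \<noteq> {}"
      then obtain i where i: "i < n" "\<rho> i = None"
        by (auto simp: free_vars_def)
      define y where "y = (\<lambda>j\<in>free_vars n \<rho>. False)"
      have y: "y \<in> cube (free_vars n \<rho>)" "y(i := True) \<in> cube (free_vars n \<rho>)"
        using i by (auto simp: y_def cube_def free_vars_def PiE_def extensional_def)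
      have "\<not> y i"
        using i by (simp add: y_def free_vars_def)
      then have "fill (y(i := True)) = (fill y)(i := \<not> fill y i)"
        using i by (auto simp: fill_def fun_eq_iff split: option.splits)
      then show False
        using iso zero[OF y(1)] zero[OF y(2)] i(1) by (simp add: isolated_zeros_def)
    qed
    then show ?thesis
      by (simp add: restricted_const_def cube_def)
  qed
qed


section \<open>A depth-2 function with many isolated zeros\<close>

definition partner :: "nat \<Rightarrow> nat" where
  "partner i = (if even i then Suc i else i - 1)"

lemma partner_partner [simp]: "partner (partner i) = i"
  by (auto simp: partner_def)

lemma partner_neq [simp]: "partner i \<noteq> i"
  by (auto simp: partner_def elim: oddE)

lemma partner_div_2 [simp]: "partner i div 2 = i div 2"
  by (auto simp: partner_def elim: oddE)

text \<open>Letting \<open>i\<close> range over both members of a pair, \<open>x i \<and> \<not> x (partner i)\<close> detects both ways in which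
  the pair can be unequal. The last variable has no partner if \<open>n\<close> is odd; its partner then counts
  as \<open>0\<close>, which forces the variable to be \<open>0\<close> in every zero.\<close>

definition unequal_pair :: "nat \<Rightarrow> (nat \<Rightarrow> bool) \<Rightarrow> bool" where
  "unequal_pair n x \<longleftrightarrow> (\<exists>i<n. x i \<and> \<not> (partner i < n \<and> x (partner i)))"

lemma isolated_zeros_unequal_pair: "isolated_zeros n (unequal_pair n)"
proof -
  have False if z: "x \<in> zeros n (unequal_pair n)" "x(i := \<not> x i) \<in> zeros n (unequal_pair n)"
    and i: "i < n" for x i
  proof -
    let ?x = "x(i := \<not> x i)"
    have 1: "partner j < n \<and> x (partner j)" if "j < n" "x j" for j
      using z(1) that by (auto simp: zeros_def unequal_pair_def)
    have 2: "partner j < n \<and> ?x (partner j)" if "j < n" "?x j" for j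
      using z(2) that unfolding zeros_def unequal_pair_def by blast
    show False
    proof (cases "x i")
      case True
      then show False using 1[of i] 2[of "partner i"] i by simp
    next
      case False
      then show False using 2[of i] 1[of "partner i"] i by simp
    qed
  qed
  then show ?thesis
    unfolding isolated_zeros_def by blast
qed

lemma finite_cube: "finite I \<Longrightarrow> finite (cube I)"
  by (simp add: cube_def finite_PiE)

text \<open>Every set of complete pairs is the support of a zero.\<close>

lemma card_zeros_unequal_pair: "2 ^ (n div 2) \<le> card (zeros n (unequal_pair n))"
proof -
  define double where "double A = (\<lambda>i\<in>{..<n}. i div 2 \<in> A)" for A :: "nat set"
  have "inj_on double (Pow {..<n div 2})"
  proof (rule inj_onI)
    fix A B assume AB: "A \<in> Pow {..<n div 2}" "B \<in> Pow {..<n div 2}" "double A = double B"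
    have "j \<in> A \<longleftrightarrow> j \<in> B" if "j < n div 2" for j
    proof -
      have "2 * j < n" using that by linarith
      then show ?thesis
        using fun_cong[OF AB(3), of "2 * j"] by (simp add: double_def)
    qed
    then show "A = B" using AB by auto
  qed
  moreover have "double ` Pow {..<n div 2} \<subseteq> zeros n (unequal_pair n)"
  proof clarify
    fix A assume A: "A \<subseteq> {..<n div 2}"
    have "partner i < n" if "i div 2 \<in> A" for i
    proof -
      have "partner i div 2 < n div 2" using A that by auto
      then show ?thesis by linarith
    qed
    then show "double A \<in> zeros n (unequal_pair n)"
      by (auto simp: zeros_def unequal_pair_def double_def cube_def)
  qed
  moreover have "finite (zeros n (unequal_pair n))"
    by (simp add: zeros_def finite_cube)
  ultimately have "card (Pow {..<n div 2}) \<le> card (zeros n (unequal_pair n))"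
    by (meson card_inj_on_le)
  then show ?thesis by (simp add: card_Pow)
qed

lemma gate_values_snoc:
  "gate_values x (gs @ [g]) = gate_values x gs @ [gate_value x (gate_values x gs) g]"
  by (simp add: gate_values_def)

text \<open>The \<open>And\<close>-gates occupy the positions below \<open>n\<close>, the output gate the position \<open>n\<close>. The two constants
  are harmless fillers: \<open>Const True\<close> replaces the literal of a missing partner, and \<open>Const False\<close> keeps
  the fan-in of the output gate nonempty for \<open>n = 0\<close>.\<close>

definition pair_gate :: "nat \<Rightarrow> nat \<Rightarrow> gate" where
  "pair_gate n i = And {Lit i True, if partner i < n then Lit (partner i) False else Const True}"

definition unequal_pair_circuit :: "nat \<Rightarrow> circuit" where
  "unequal_pair_circuit n =
     Circuit (map (pair_gate n) [0..<n] @ [Or (insert (Const False) (Gate ` {..<n}))]) (Gate n)"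

lemma gate_values_pair_gates:
  "gate_values x (map (pair_gate n) [0..<m]) =
     map (\<lambda>i. x i \<and> \<not> (partner i < n \<and> x (partner i))) [0..<m]"
proof (induction m)
  case 0
  show ?case by (simp add: gate_values_def)
next
  case (Suc m)
  then show ?case by (simp add: gate_values_snoc pair_gate_def)
qed

lemma circuit_value_unequal_pair_circuit:
  "circuit_value (unequal_pair_circuit n) x = unequal_pair n x"
  by (auto simp: circuit_value_def unequal_pair_circuit_def gate_values_snoc
      gate_values_pair_gates unequal_pair_def nth_append)

lemma wf_unequal_pair_circuit: "wf_circuit n (unequal_pair_circuit n)"
  by (auto simp: wf_circuit_def unequal_pair_circuit_def nth_append pair_gate_def less_Suc_eq)

inductive_cases input_path_ConstE: "input_path gs (Const b) m"
inductive_cases input_path_LitE: "input_path gs (Lit i b) m"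
inductive_cases input_path_GateE: "input_path gs (Gate j) m"

lemma circuit_depth_unequal_pair_circuit: "circuit_depth (unequal_pair_circuit n) \<le> 2"
proof -
  let ?gs = "gates (unequal_pair_circuit n)"
  let ?M = "{m. input_path ?gs (Gate n) m}"
  have gs_nth: "?gs ! i = pair_gate n i" if "i < n" for i
    using that by (simp add: unequal_pair_circuit_def nth_append)
  have gs_out: "?gs ! n = Or (insert (Const False) (Gate ` {..<n}))"
    by (simp add: unequal_pair_circuit_def nth_append)
  have pair: "m = 1" if "input_path ?gs (Gate i) m" "i < n" for i m
    using that(1)
    by (rule input_path_GateE)
      (auto simp: gs_nth that(2) pair_gate_def split: if_splits
        elim: input_path_ConstE input_path_LitE)
  have bound: "?M \<subseteq> {..2}"
  proof
    fix m assume "m \<in> ?M"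
    then have "input_path ?gs (Gate n) m" by simp
    then show "m \<in> {..2}"
      by (rule input_path_GateE) (auto simp: gs_out dest: pair elim: input_path_ConstE)
  qed
  \<comment> \<open>The depth is a \<open>Max\<close>, which is only meaningful for a nonempty set.\<close>
  have "input_path ?gs (Gate n) (Suc 0)"
    by (rule input_path.gate[where v = "Const False"])
      (auto simp: gs_out intro: input_path.const, simp add: unequal_pair_circuit_def)
  then have "?M \<noteq> {}" by blast
  moreover have "finite ?M"
    using bound by (rule finite_subset) simp
  ultimately have "Max ?M \<in> ?M" by (rule Max_in[rotated])
  then have "Max ?M \<le> 2" using bound by blast
  then show ?thesis
    by (simp add: circuit_depth_def unequal_pair_circuit_def)
qed

lemma unequal_pair_in_AC0_depth_2: "unequal_pair \<in> AC0_depth 2"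
proof -
  have "circuit_size (unequal_pair_circuit n) \<le> 1 * n ^ 1 + 1" for n
    by (simp add: circuit_size_def unequal_pair_circuit_def)
  then have "\<exists>c k. \<forall>n. circuit_size (unequal_pair_circuit n) \<le> c * n ^ k + c"
    by blast
  then show ?thesis
    unfolding AC0_depth_def
    using wf_unequal_pair_circuit circuit_depth_unequal_pair_circuit
      circuit_value_unequal_pair_circuit by blast
qed


section \<open>Counting circuits\<close>

definition small_circuits :: "nat \<Rightarrow> nat \<Rightarrow> circuit set" where
  "small_circuits n s = {C. wf_circuit n C \<and> circuit_size C \<le> s}"

lemma wf_node_mono: "wf_node n k v \<Longrightarrow> k \<le> l \<Longrightarrow> wf_node n l v"
  by (cases v) auto

lemma wf_nodes_eq:
  "{v. wf_node n k v} = range Const \<union> (\<lambda>(i, b). Lit i b) ` ({..<n} \<times> UNIV) \<union> Gate ` {..<k}"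
proof -
  have "wf_node n k v \<longleftrightarrow> v \<in> range Const \<union> (\<lambda>(i, b). Lit i b) ` ({..<n} \<times> UNIV) \<union> Gate ` {..<k}" for v
    by (cases v) auto
  then show ?thesis by blast
qed

lemma finite_wf_nodes: "finite {v. wf_node n k v}"
  by (simp add: wf_nodes_eq)

lemma card_wf_nodes: "card {v. wf_node n k v} \<le> 2 * n + k + 2"
proof -
  have "card (range Const) \<le> 2"
    using card_image_le[of UNIV Const] by simp
  moreover have "card ((\<lambda>(i, b). Lit i b) ` ({..<n} \<times> UNIV)) \<le> 2 * n"
    using card_image_le[of "{..<n} \<times> UNIV" "\<lambda>(i, b). Lit i b"] by (simp add: card_cartesian_product)
  moreover have "card (Gate ` {..<k}) \<le> k"
    using card_image_le[of "{..<k}" Gate] by simp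
  ultimately show ?thesis
    unfolding wf_nodes_eq
    using card_Un_le[of "range Const \<union> (\<lambda>(i, b). Lit i b) ` ({..<n} \<times> UNIV)" "Gate ` {..<k}"]
      card_Un_le[of "range Const" "(\<lambda>(i, b). Lit i b) ` ({..<n} \<times> UNIV)"]
    by linarith
qed

lemma sum_powers_le:
  fixes a :: nat
  assumes "2 \<le> a"
  shows "(\<Sum>i\<le>n. a ^ i) \<le> a ^ Suc n"
proof (induction n)
  case 0
  show ?case using assms by simp
next
  case (Suc n)
  have "(\<Sum>i\<le>Suc n. a ^ i) \<le> 2 * a ^ Suc n" using Suc by simp
  also have "\<dots> \<le> a * a ^ Suc n" using assms by (intro mult_right_mono) auto
  finally show ?case by simp
qed

text \<open>A gate is determined by its kind and by its fan-in, a set of at most \<open>2 * n + s + 2\<close> nodes. A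
  circuit is a list of at most \<open>s\<close> gates together with an output node.\<close>

lemma
  fixes n s :: nat
  defines "N \<equiv> 2 * n + s + 2"
  shows finite_small_circuits: "finite (small_circuits n s)"
    and card_small_circuits: "card (small_circuits n s) \<le> 2 ^ ((N + 1) * (s + 1) + N)"
proof -
  define V where "V = {v. wf_node n s v}"
  define G where "G = And ` Pow V \<union> Or ` Pow V"
  define L where "L = {gs. set gs \<subseteq> G \<and> length gs \<le> s}"
  have V: "finite V" "card V \<le> N"
    using finite_wf_nodes card_wf_nodes by (auto simp: V_def N_def)
  have G: "finite G" "card G \<le> 2 ^ (N + 1)"
  proof -
    show "finite G" using V by (simp add: G_def)
    have "card G \<le> card (Pow V) + card (Pow V)"
      unfolding G_def using V(1)
      by (intro order_trans[OF card_Un_le] add_mono card_image_le) auto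
    also have "\<dots> = 2 * 2 ^ card V" using V(1) by (simp add: card_Pow)
    also have "\<dots> \<le> 2 * 2 ^ N" using V(2) by (intro mult_left_mono power_increasing) auto
    finally show "card G \<le> 2 ^ (N + 1)" by simp
  qed
  have L: "finite L" "card L \<le> 2 ^ ((N + 1) * (s + 1))"
  proof -
    show "finite L" using finite_lists_length_le[OF G(1)] by (simp add: L_def)
    have "card L = (\<Sum>i\<le>s. card G ^ i)"
      using card_lists_length_le[OF G(1)] by (simp add: L_def)
    also have "\<dots> \<le> (\<Sum>i\<le>s. (2 ^ (N + 1)) ^ i)"
      using G(2) by (intro sum_mono power_mono) auto
    also have "\<dots> \<le> (2 ^ (N + 1)) ^ Suc s"
      by (rule sum_powers_le) simp
    finally show "card L \<le> 2 ^ ((N + 1) * (s + 1))"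
      by (simp only: power_mult Suc_eq_plus1)
  qed
  have sub: "small_circuits n s \<subseteq> (\<lambda>(gs, v). Circuit gs v) ` (L \<times> V)"
  proof
    fix C assume C: "C \<in> small_circuits n s"
    obtain gs v where C_eq: "C = Circuit gs v" by (cases C)
    have len: "length gs \<le> s" and v: "wf_node n (length gs) v"
      and fanin: "\<And>k u. k < length gs \<Longrightarrow> u \<in> fanin (gs ! k) \<Longrightarrow> wf_node n k u"
      using C by (auto simp: C_eq small_circuits_def wf_circuit_def circuit_size_def)
    have "g \<in> G" if "g \<in> set gs" for g
    proof -
      obtain k where k: "k < length gs" "g = gs ! k"
        using \<open>g \<in> set gs\<close> by (auto simp: in_set_conv_nth)
      have "k \<le> s" using k(1) len by simp
      then have "fanin g \<subseteq> V"
        using fanin[OF k(1)] k(2) by (auto simp: V_def intro: wf_node_mono)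
      then show "g \<in> G" by (cases g) (auto simp: G_def)
    qed
    then have "gs \<in> L" using len by (auto simp: L_def)
    moreover have "v \<in> V" using v len by (auto simp: V_def intro: wf_node_mono)
    ultimately show "C \<in> (\<lambda>(gs, v). Circuit gs v) ` (L \<times> V)" by (auto simp: C_eq)
  qed
  have fin: "finite (L \<times> V)" using L V by simp
  show "finite (small_circuits n s)"
    using sub fin by (meson finite_imageI finite_subset)
  have "card (small_circuits n s) \<le> card (L \<times> V)"
    using fin sub by (rule surj_card_le)
  also have "\<dots> \<le> 2 ^ ((N + 1) * (s + 1)) * N"
    using L V by (simp add: card_cartesian_product mult_mono)
  also have "\<dots> \<le> 2 ^ ((N + 1) * (s + 1)) * 2 ^ N"
    by (intro mult_left_mono less_imp_le less_exp) auto
  finally show "card (small_circuits n s) \<le> 2 ^ ((N + 1) * (s + 1) + N)"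
    by (simp only: power_add)
qed

definition accepted :: "nat \<Rightarrow> circuit \<Rightarrow> (nat \<Rightarrow> bool) set" where
  "accepted n C = {x \<in> cube {..<n}. circuit_value C x}"

lemma exists_hard_subset:
  assumes "finite Z" "(2 * n + s + 3) * (s + 1) + (2 * n + s + 2) < card Z"
  shows "\<exists>T \<subseteq> Z. T \<notin> accepted n ` small_circuits n s"
proof (rule ccontr)
  assume "\<not> ?thesis"
  then have "Pow Z \<subseteq> accepted n ` small_circuits n s" by blast
  then have "card (Pow Z) \<le> card (small_circuits n s)"
    by (rule surj_card_le[OF finite_small_circuits])
  also have "\<dots> \<le> 2 ^ ((2 * n + s + 3) * (s + 1) + (2 * n + s + 2))"
    using card_small_circuits[of n s] by (simp only: add.assoc numeral_plus_one semiring_norm)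
  also have "\<dots> < 2 ^ card Z"
    using assms(2) by (intro power_strict_increasing) auto
  finally show False
    using assms(1) by (simp add: card_Pow)
qed

text \<open>With \<open>w = n div 8\<close> the exponent in the number of circuits is at most \<open>53 * 4 ^ w\<close>, because
  \<open>w + 1 \<le> 2 ^ w\<close>, while there are at least \<open>2 ^ (n div 2) \<ge> 16 ^ w\<close> zeros; \<open>w \<ge> 3\<close> makes \<open>53 < 4 ^ w\<close>.\<close>

lemma circuit_count_exponent_less:
  fixes n :: nat
  assumes "24 \<le> n"
  defines "s \<equiv> 2 ^ (n div 8)"
  shows "(2 * n + s + 3) * (s + 1) + (2 * n + s + 2) < 2 ^ (n div 2)"
proof -
  define w where "w = n div 8"
  have w: "3 \<le> w" "n \<le> 8 * w + 7" "4 * w \<le> n div 2"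
    using assms by (auto simp: w_def)
  have s: "s = 2 ^ w" by (simp add: s_def w_def)
  have "w + 1 \<le> s" unfolding s using less_exp[of w] by (simp only: Suc_eq_plus1[symmetric] Suc_le_eq)
  then have N: "2 * n + s + 2 \<le> 17 * s" and s1: "1 \<le> s" using w by auto
  have "(2 * n + s + 3) * (s + 1) + (2 * n + s + 2) \<le> (18 * s) * (2 * s) + 17 * s"
    using N s1 by (intro add_mono mult_mono) auto
  also have "\<dots> \<le> 53 * s ^ 2"
    using s1 by (simp add: power2_eq_square)
  also have "\<dots> < 2 ^ 6 * s ^ 2" using s1 by simp
  also have "\<dots> = 2 ^ (6 + 2 * w)"
    by (simp only: s power_add power_mult power_mult_distrib mult.commute flip: power_mult)
  also have "\<dots> \<le> 2 ^ (n div 2)"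
    using w by (intro power_increasing) auto
  finally show ?thesis .
qed

text \<open>Along the multiples \<open>n = 8 * w\<close> the size bound \<open>2 ^ (n div 8)\<close> is \<open>2 ^ w\<close>, which dominates any
  polynomial in \<open>8 * w\<close>.\<close>

lemma polynomial_le_exp_div_8: "\<exists>n\<ge>24. c * n ^ k + c \<le> (2::nat) ^ (n div 8)"
proof -
  have "eventually (\<lambda>w. real c * (8 * real w) ^ k + real c \<le> 2 ^ w) at_top"
    by real_asymp
  then have "eventually (\<lambda>w::nat. c * (8 * w) ^ k + c \<le> 2 ^ w) at_top"
    by eventually_elim (simp flip: of_nat_le_iff[where 'a = real])
  then obtain w where "3 \<le> w" "c * (8 * w) ^ k + c \<le> 2 ^ w"
    by (metis (no_types, lifting) eventually_at_top_linorder nle_le)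
  then show ?thesis by (intro exI[of _ "8 * w"]) auto
qed


section \<open>A hard function on the isolated zeros\<close>

theorem theorem5p8:
  "\<exists>f g :: nat \<Rightarrow> (nat \<Rightarrow> bool) \<Rightarrow> bool.
     f \<in> AC0_depth 2 \<and> g \<notin> AC0 \<and>
     (\<forall>n. \<forall>\<rho> \<in> restrictions n. restricted_const n (f n) \<rho> \<longrightarrow> restricted_const n (g n) \<rho>)"
proof -
  let ?Z = "\<lambda>n. zeros n (unequal_pair n)"
  have "\<exists>T \<subseteq> ?Z n. 24 \<le> n \<longrightarrow> T \<notin> accepted n ` small_circuits n (2 ^ (n div 8))" for n
  proof (cases "24 \<le> n")
    case True
    have "finite (?Z n)" by (simp add: zeros_def finite_cube)
    then have "\<exists>T \<subseteq> ?Z n. T \<notin> accepted n ` small_circuits n (2 ^ (n div 8))"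
      using less_le_trans[OF circuit_count_exponent_less[OF True] card_zeros_unequal_pair]
      by (rule exists_hard_subset)
    then show ?thesis by auto
  qed auto
  then obtain T where T: "\<And>n. T n \<subseteq> ?Z n"
    and hard: "\<And>n. 24 \<le> n \<Longrightarrow> T n \<notin> accepted n ` small_circuits n (2 ^ (n div 8))"
    by metis
  let ?g = "\<lambda>n x. x \<in> T n"
  have "?g \<notin> AC0"
  proof
    assume "?g \<in> AC0"
    then obtain d where "?g \<in> AC0_depth d" by (auto simp: AC0_def)
    then obtain C c k where
      C: "\<forall>n. wf_circuit n (C n) \<and> circuit_depth (C n) \<le> d \<and>
            (\<forall>x \<in> cube {..<n}. circuit_value (C n) x = (x \<in> T n))"
      and size: "\<forall>n. circuit_size (C n) \<le> c * n ^ k + c"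
      unfolding AC0_depth_def by blast
    obtain n where n: "24 \<le> n" "c * n ^ k + c \<le> 2 ^ (n div 8)"
      using polynomial_le_exp_div_8 by blast
    have "C n \<in> small_circuits n (2 ^ (n div 8))"
      using C order_trans[OF size[rule_format] n(2)] by (simp add: small_circuits_def)
    moreover have "T n = accepted n (C n)"
      using C T[of n] by (auto simp: accepted_def zeros_def)
    ultimately show False using hard[OF n(1)] by blast
  qed
  moreover have "restricted_const n (?g n) \<rho>" if "restricted_const n (unequal_pair n) \<rho>" for n \<rho>
  proof (rule restricted_const_if_isolated_zeros[OF isolated_zeros_unequal_pair _ that])
    show "\<not> unequal_pair n x" if "x \<in> T n" for x
      using T that by (auto simp: zeros_def)
  qed
  ultimately have "unequal_pair \<in> AC0_depth 2 \<and> ?g \<notin> AC0 \<and>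
      (\<forall>n. \<forall>\<rho> \<in> restrictions n.
        restricted_const n (unequal_pair n) \<rho> \<longrightarrow> restricted_const n (?g n) \<rho>)"
    using unequal_pair_in_AC0_depth_2 by simp
  then show ?thesis by (intro exI)
qed

end
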